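(* Let $0<\lambda\le\Lambda$. There is a constant $C>0$ depending only on $\lambda,\Lambda$ such that the following holds for every operator $L=a_{11}X_1^2+2a_{12}X_2X_1+a_{22}X_2^2$ with ellipticity constants $\lambda,\Lambda$. Let $\Omega\subset\mathbb{R}^2$ be a bounded domain, let $u\in C(\overline\Omega)\cap C^2(\Omega)$ with $u\ge 0$ on $\partial\Omega$, let $f$ be a bounded measurable function on $\Omega$, and assume that $$Lu(x)\le f(x)\,x_1^2\qquad\text{for all }x=(x_1,x_2)\in\Omega .$$ Let $d=\operatorname{diam}(\Omega)$ be the Euclidean diameter of $\Omega$, let $B_{\mathcal E}(2d)$ be a Euclidean ball of radius $2d$ with $\Omega\subset B_{\mathcal E}(2d)$, extend $u\equiv 0$ outside $\Omega$, and let $\Gamma_u$ be the convex envelope of $-u^-$ in $B_{\mathcal E}(2d)$. Then $$\sup_{\Omega}u^-\le C\,\operatorname{diam}(\Omega)\left(\int_{\Omega\cap\{u=\Gamma_u\}}\big(f^+(x)\big)^2x_1^2\,dx\right)^{1/2}.$$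
   Context: On $\mathbb{R}^2$ with points $x=(x_1,x_2)$, let $X_1=\partial_{x_1}$ and $X_2=x_1\partial_{x_2}$ (Grushin vector fields). The operator is $L=a_{11}X_1^2+2a_{12}X_2X_1+a_{22}X_2^2$, i.e. $Lu=a_{11}u_{x_1x_1}+2a_{12}X_2X_1u+a_{22}X_2^2u$ with $X_2X_1u=x_1u_{x_1x_2}$ and $X_2^2u=x_1^2u_{x_2x_2}$, where $a_{11},a_{12},a_{22}$ are measurable real functions on $\mathbb{R}^2$ such that at every point $\lambda(\xi_1^2+\xi_2^2)\le a_{11}\xi_1^2+2a_{12}\xi_1\xi_2+a_{22}\xi_2^2\le\Lambda(\xi_1^2+\xi_2^2)$ for all $\xi\in\mathbb{R}^2$; then $\lambda,\Lambda$ are called ellipticity constants of $L$. Notation: $u^-=\max\{-u,0\}$, $f^+=\max\{f,0\}$. The convex envelope of a continuous function $w$ in an open convex set $D$ is $\Gamma(w)(x)=\sup\{\ell(x):\ell\text{ affine},\ \ell\le w\text{ in }D\}$ for $x\in D$. *)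

theory Defs
  imports "HOL-Analysis.Analysis"
begin

definition partial_deriv :: "2 \<Rightarrow> (real^2 \<Rightarrow> real) \<Rightarrow> real^2 \<Rightarrow> real" where
  "partial_deriv i u x = deriv (\<lambda>t. u (x + t *\<^sub>R axis i 1)) 0"

definition C1_on :: "(real^2) set \<Rightarrow> (real^2 \<Rightarrow> real) \<Rightarrow> bool" where
  "C1_on S u \<longleftrightarrow> continuous_on S u \<and>
     (\<forall>i. (\<forall>x\<in>S. (\<lambda>t. u (x + t *\<^sub>R axis i 1)) field_differentiable at 0) \<and>
          continuous_on S (partial_deriv i u))"

definition C2_on :: "(real^2) set \<Rightarrow> (real^2 \<Rightarrow> real) \<Rightarrow> bool" where
  "C2_on S u \<longleftrightarrow> C1_on S u \<and> (\<forall>i. C1_on S (partial_deriv i u))"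

definition X1 :: "(real^2 \<Rightarrow> real) \<Rightarrow> real^2 \<Rightarrow> real" where
  "X1 u x = partial_deriv 1 u x"

definition X2 :: "(real^2 \<Rightarrow> real) \<Rightarrow> real^2 \<Rightarrow> real" where
  "X2 u x = x $ 1 * partial_deriv 2 u x"

definition grushin_op ::
  "(real^2 \<Rightarrow> real) \<Rightarrow> (real^2 \<Rightarrow> real) \<Rightarrow> (real^2 \<Rightarrow> real) \<Rightarrow> (real^2 \<Rightarrow> real) \<Rightarrow> real^2 \<Rightarrow> real" where
  "grushin_op a11 a12 a22 u x =
     a11 x * X1 (X1 u) x + 2 * a12 x * X2 (X1 u) x + a22 x * X2 (X2 u) x"

lemma X2_X2:
  assumes "C2_on S u" "x \<in> S"
  shows "X2 (X2 u) x = (x $ 1)\<^sup>2 * partial_deriv 2 (partial_deriv 2 u) x"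
proof -
  have "(\<lambda>t. partial_deriv 2 u (x + t *\<^sub>R axis 2 1)) field_differentiable at 0"
    using assms by (simp add: C2_on_def C1_on_def)
  then show ?thesis
    by (simp add: X2_def partial_deriv_def[of 2 "X2 u"] partial_deriv_def[of 2 "partial_deriv 2 u"]
        axis_def power2_eq_square)
qed

definition ellipticity_constants ::
  "real \<Rightarrow> real \<Rightarrow> (real^2 \<Rightarrow> real) \<Rightarrow> (real^2 \<Rightarrow> real) \<Rightarrow> (real^2 \<Rightarrow> real) \<Rightarrow> bool" where
  "ellipticity_constants l L a11 a12 a22 \<longleftrightarrow>
     (\<forall>x. \<forall>\<xi>::real^2.
        l * ((\<xi> $ 1)\<^sup>2 + (\<xi> $ 2)\<^sup>2)
          \<le> a11 x * (\<xi> $ 1)\<^sup>2 + 2 * a12 x * \<xi> $ 1 * \<xi> $ 2 + a22 x * (\<xi> $ 2)\<^sup>2 \<and>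
        a11 x * (\<xi> $ 1)\<^sup>2 + 2 * a12 x * \<xi> $ 1 * \<xi> $ 2 + a22 x * (\<xi> $ 2)\<^sup>2
          \<le> L * ((\<xi> $ 1)\<^sup>2 + (\<xi> $ 2)\<^sup>2))"

definition pos_part :: "('a \<Rightarrow> real) \<Rightarrow> 'a \<Rightarrow> real" where
  "pos_part f x = max (f x) 0"

definition neg_part :: "('a \<Rightarrow> real) \<Rightarrow> 'a \<Rightarrow> real" where
  "neg_part u x = max (- u x) 0"

definition zero_extension :: "'a set \<Rightarrow> ('a \<Rightarrow> real) \<Rightarrow> 'a \<Rightarrow> real" where
  "zero_extension \<Omega> u x = (if x \<in> \<Omega> then u x else 0)"

text \<open>The affine functions are those of the form \<open>y \<mapsto> p \<bullet> y + c\<close>. The supremum is the usual one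
  whenever \<open>x \<in> D\<close> (so that \<open>w x\<close> is an upper bound) and \<open>w\<close> has an affine minorant on \<open>D\<close>.\<close>

definition convex_envelope ::
  "'a::euclidean_space set \<Rightarrow> ('a \<Rightarrow> real) \<Rightarrow> 'a \<Rightarrow> real" where
  "convex_envelope D w x = Sup {p \<bullet> x + c | p c. \<forall>y\<in>D. p \<bullet> y + c \<le> w y}"

end

theory Submission
  imports Defs
begin

text \<open>The proof follows Alexandrov, Bakelman and Pucci. Let \<open>d\<close> be the diameter of the
  domain. If \<open>u x0 = - M < 0\<close>, every slope \<open>p\<close> with
  \<open>norm p < M / (4 * d)\<close> is the gradient of \<open>u\<close> at some contact point where the Hessian is positive
  semidefinite, so the gradient image of these points has area at least \<open>pi * (M / (4 * d))\<^sup>2\<close>. This area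
  is at most the integral of \<open>det (hess u x)\<close>. The matrix with entries \<open>X_i X_j u\<close> has determinant
  \<open>(x $ 1)\<^sup>2 * det (hess u x)\<close>, and ellipticity bounds this, where it is
  nonnegative, by \<open>(pos_part f x)\<^sup>2 * (x $ 1)^4 / (4 * l\<^sup>2)\<close>; one factor \<open>(x $ 1)\<^sup>2\<close> cancels.\<close>

section \<open>Functions with continuous partial derivatives in the plane\<close>

text \<open>\<open>C1_on\<close> gives the derivative along an axis only at parameter 0. Moving the
  base point along the line gives it at every parameter, as the mean value theorem requires.\<close>

lemma C1_on_has_real_derivative:
  assumes "C1_on S u" "x + t *\<^sub>R axis i 1 \<in> S"
  shows "((\<lambda>s. u (x + s *\<^sub>R axis i 1)) has_real_derivative partial_deriv i u (x + t *\<^sub>R axis i 1)) (at t)"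
proof -
  have "(\<lambda>s. u ((x + t *\<^sub>R axis i 1) + s *\<^sub>R axis i 1)) field_differentiable at 0"
    using assms unfolding C1_on_def by blast
  then have "((\<lambda>s. u ((x + t *\<^sub>R axis i 1) + s *\<^sub>R axis i 1)) has_real_derivative
      partial_deriv i u (x + t *\<^sub>R axis i 1)) (at 0)"
    unfolding partial_deriv_def by (simp add: DERIV_deriv_iff_field_differentiable)
  then have "((\<lambda>s. u (x + (s + t) *\<^sub>R axis i 1)) has_real_derivative
      partial_deriv i u (x + t *\<^sub>R axis i 1)) (at 0)"
    by (simp add: algebra_simps)
  then show ?thesis
    using DERIV_shift[of "\<lambda>s. u (x + s *\<^sub>R axis i 1)" _ 0 t] by simp
qed

lemma C1_on_mvt:
  assumes u: "C1_on S u" and seg: "closed_segment x (x + h *\<^sub>R axis i 1) \<subseteq> S"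
  obtains y where "y \<in> closed_segment x (x + h *\<^sub>R axis i 1)"
    "u (x + h *\<^sub>R axis i 1) - u x = h * partial_deriv i u y"
proof -
  let ?g = "\<lambda>s. u (x + s *\<^sub>R (h *\<^sub>R axis i 1))"
  have mem: "x + s *\<^sub>R (h *\<^sub>R axis i 1) \<in> closed_segment x (x + h *\<^sub>R axis i 1)" if "0 \<le> s" "s \<le> 1" for s
    using that by (auto simp: in_segment algebra_simps intro!: exI[of _ s])
  have "(?g has_real_derivative h * partial_deriv i u (x + s *\<^sub>R (h *\<^sub>R axis i 1))) (at s)"
    if "0 \<le> s" "s \<le> 1" for s
  proof -
    have "((\<lambda>s. u (x + s *\<^sub>R axis i 1)) has_real_derivative
      partial_deriv i u (x + (s * h) *\<^sub>R axis i 1)) (at (s * h))"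
      using C1_on_has_real_derivative[OF u] mem[OF that] seg by auto
    from DERIV_chain2[where f="\<lambda>s. u (x + s *\<^sub>R axis i 1)" and g="\<lambda>s. s * h", OF this, of h UNIV]
    have "((\<lambda>s. s * h) has_real_derivative h) (at s) \<Longrightarrow> ?thesis" by (simp add: mult.commute)
    moreover have "((\<lambda>s. s * h) has_real_derivative h) (at s)" by (auto intro!: derivative_eq_intros)
    ultimately show ?thesis by blast
  qed
  from MVT2[of 0 1 ?g, OF _ this] obtain s where "0 < s" "s < 1"
    "?g 1 - ?g 0 = h * partial_deriv i u (x + s *\<^sub>R (h *\<^sub>R axis i 1))" by auto
  with mem[of s] show ?thesis by (intro that) auto
qed

text \<open>Only partial derivatives are given, so total differentiability has to be proved. The
  increment of \<open>u\<close> is split along a two-leg axis-parallel path; the mean value theorem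
  on each leg yields partial derivatives at nearby points, and their continuity at \<open>x\<close>
  makes the error small.\<close>

lemma C1_on_has_derivative:
  assumes "open S" and u: "C1_on S u" and x: "x \<in> S"
  shows "(u has_derivative (\<lambda>h. h$1 * partial_deriv 1 u x + h$2 * partial_deriv 2 u x)) (at x)"
  unfolding has_derivative_at_alt
proof (intro conjI allI impI)
  show "bounded_linear (\<lambda>h::real^2. h$1 * partial_deriv 1 u x + h$2 * partial_deriv 2 u x)"
    by (intro bounded_linear_add bounded_linear_mult_const bounded_linear_vec_nth)
next
  fix e :: real assume "e > 0"
  obtain r where r: "r > 0" "ball x r \<subseteq> S" using assms open_contains_ball by blast
  have "\<exists>d>0. \<forall>y\<in>S. dist y x < d \<longrightarrow> dist (partial_deriv i u y) (partial_deriv i u x) < e/2" for i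
    using u x \<open>e > 0\<close> unfolding C1_on_def continuous_on_iff by (meson half_gt_zero)
  then obtain d where d: "\<And>i. d i > 0"
    "\<And>i y. y \<in> S \<Longrightarrow> dist y x < d i \<Longrightarrow> dist (partial_deriv i u y) (partial_deriv i u x) < e/2"
    by metis
  define \<rho> where "\<rho> = Min {r, d 1, d 2}"
  have \<rho>: "\<rho> > 0" "\<rho> \<le> r" "\<rho> \<le> d 1" "\<rho> \<le> d 2" using r d by (auto simp: \<rho>_def)
  have i12: "i = 1 \<or> i = 2" for i :: 2 using exhaust_2 by auto
  have close: "\<bar>partial_deriv i u y - partial_deriv i u x\<bar> \<le> e/2" if "y \<in> ball x \<rho>" for i y
  proof -
    have "y \<in> S" "dist y x < d i"
      using that r \<rho> i12[of i] by (auto simp: dist_commute subset_iff)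
    then show ?thesis using d(2) by (fastforce simp: dist_real_def)
  qed
  show "\<exists>d>0. \<forall>y. norm (y - x) < d \<longrightarrow>
      norm (u y - u x - ((y - x)$1 * partial_deriv 1 u x + (y - x)$2 * partial_deriv 2 u x)) \<le> e * norm (y - x)"
  proof (intro exI[of _ \<rho>] conjI allI impI)
    fix y assume y: "norm (y - x) < \<rho>"
    define h where "h = y - x"
    \<comment> \<open>The corner of the path: the first leg changes the first coordinate, the second
      leg the other. Convexity keeps both legs in the ball.\<close>
    define m where "m = x + h$1 *\<^sub>R axis 1 1"
    have y_eq: "y = m + h$2 *\<^sub>R axis 2 1"
      by (simp add: m_def h_def vec_eq_iff forall_2 axis_def)
    have mb: "m \<in> ball x \<rho>"
      using y component_le_norm_cart[of h 1] by (simp add: m_def h_def dist_norm norm_axis_1)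
    have yb: "y \<in> ball x \<rho>" using y by (simp add: dist_norm norm_minus_commute)
    have bS: "ball x \<rho> \<subseteq> S" using r \<rho> by auto
    have s1: "closed_segment x m \<subseteq> ball x \<rho>" and s2: "closed_segment m y \<subseteq> ball x \<rho>"
      using mb yb \<rho>(1) by (intro closed_segment_subset convex_ball; simp)+
    obtain \<xi> where \<xi>: "\<xi> \<in> closed_segment x m" "u m - u x = h$1 * partial_deriv 1 u \<xi>"
      using C1_on_mvt[OF u, of x "h$1" 1] s1 bS unfolding m_def by blast
    obtain \<eta> where \<eta>: "\<eta> \<in> closed_segment m y" "u y - u m = h$2 * partial_deriv 2 u \<eta>"
      using C1_on_mvt[OF u, of m "h$2" 2] s2 bS unfolding y_eq by blast
    have "u y - u x - (h$1 * partial_deriv 1 u x + h$2 * partial_deriv 2 u x)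
        = h$1 * (partial_deriv 1 u \<xi> - partial_deriv 1 u x) + h$2 * (partial_deriv 2 u \<eta> - partial_deriv 2 u x)"
      using \<xi> \<eta> by (simp add: algebra_simps)
    also have "\<bar>\<dots>\<bar> \<le> \<bar>h$1\<bar> * \<bar>partial_deriv 1 u \<xi> - partial_deriv 1 u x\<bar> + \<bar>h$2\<bar> * \<bar>partial_deriv 2 u \<eta> - partial_deriv 2 u x\<bar>"
      using abs_triangle_ineq by (metis abs_mult)
    also have "\<dots> \<le> norm h * (e/2) + norm h * (e/2)"
      using close \<xi>(1) \<eta>(1) s1 s2 by (intro add_mono mult_mono component_le_norm_cart) auto
    finally show "norm (u y - u x - ((y - x)$1 * partial_deriv 1 u x + (y - x)$2 * partial_deriv 2 u x)) \<le> e * norm (y - x)"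
      by (simp add: h_def mult.commute)
  qed (use \<rho> in auto)
qed

text \<open>Both mixed derivatives are limits of the same second difference quotient.\<close>

lemma second_difference_mixed:
  assumes u: "C1_on S u" and ui: "C1_on S (partial_deriv i u)" and h: "h > 0"
    and sub: "\<And>s t. 0 \<le> s \<Longrightarrow> s \<le> h \<Longrightarrow> 0 \<le> t \<Longrightarrow> t \<le> h \<Longrightarrow> x + s *\<^sub>R axis i 1 + t *\<^sub>R axis j 1 \<in> S"
  obtains s t where "0 \<le> s" "s \<le> h" "0 \<le> t" "t \<le> h"
    "u (x + h *\<^sub>R axis i 1 + h *\<^sub>R axis j 1) - u (x + h *\<^sub>R axis i 1) - u (x + h *\<^sub>R axis j 1) + u x
      = h\<^sup>2 * partial_deriv j (partial_deriv i u) (x + s *\<^sub>R axis i 1 + t *\<^sub>R axis j 1)"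
proof -
  \<comment> \<open>The second difference is \<open>\<phi> h - \<phi> 0\<close>. The mean value
    theorem is applied to \<open>\<phi>\<close> in direction \<open>i\<close>, then in direction
    \<open>j\<close> to the resulting difference of values of
    \<open>partial_deriv i u\<close>.\<close>
  define \<phi> where "\<phi> = (\<lambda>s. u (x + h *\<^sub>R axis j 1 + s *\<^sub>R axis i 1) - u (x + s *\<^sub>R axis i 1))"
  have "(\<phi> has_real_derivative partial_deriv i u (x + h *\<^sub>R axis j 1 + s *\<^sub>R axis i 1)
      - partial_deriv i u (x + s *\<^sub>R axis i 1)) (at s)" if "0 \<le> s" "s \<le> h" for s
    unfolding \<phi>_def using that h sub[of s 0] sub[of s h]
    by (intro DERIV_diff C1_on_has_real_derivative[OF u]) (auto simp: algebra_simps)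
  from MVT2[OF h this] obtain s where s: "0 < s" "s < h" "\<phi> h - \<phi> 0 =
     h * (partial_deriv i u (x + h *\<^sub>R axis j 1 + s *\<^sub>R axis i 1) - partial_deriv i u (x + s *\<^sub>R axis i 1))"
    by auto
  have "((\<lambda>t. partial_deriv i u (x + s *\<^sub>R axis i 1 + t *\<^sub>R axis j 1)) has_real_derivative
      partial_deriv j (partial_deriv i u) (x + s *\<^sub>R axis i 1 + t *\<^sub>R axis j 1)) (at t)" if "0 \<le> t" "t \<le> h" for t
    using that s sub[of s t] by (intro C1_on_has_real_derivative[OF ui]) auto
  from MVT2[OF h this] obtain t where t: "0 < t" "t < h"
    "partial_deriv i u (x + s *\<^sub>R axis i 1 + h *\<^sub>R axis j 1) - partial_deriv i u (x + s *\<^sub>R axis i 1)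
      = h * partial_deriv j (partial_deriv i u) (x + s *\<^sub>R axis i 1 + t *\<^sub>R axis j 1)" by auto
  show ?thesis
    by (rule that[of s t]) (use s t in \<open>auto simp: \<phi>_def algebra_simps power2_eq_square\<close>)
qed

text \<open>If the mixed derivatives differed at \<open>x\<close>, continuity would keep them apart
  on a small square, yet each of them equals the common second difference over
  \<open>h\<^sup>2\<close> somewhere in the square.\<close>

lemma partial_deriv_commute:
  assumes S: "open S" and u: "C2_on S u" and x: "x \<in> S"
  shows "partial_deriv j (partial_deriv i u) x = partial_deriv i (partial_deriv j u) x"
proof (rule ccontr)
  define F where "F = partial_deriv j (partial_deriv i u)"
  define G where "G = partial_deriv i (partial_deriv j u)"
  assume "\<not> ?thesis"
  then have e: "\<bar>F x - G x\<bar> / 2 > 0" (is "?e > 0") by (simp add: F_def G_def)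
  have C1: "C1_on S u" "C1_on S (partial_deriv k u)" for k using u by (auto simp: C2_on_def)
  have near: "\<exists>d>0. \<forall>y\<in>S. dist y x < d \<longrightarrow> dist (K y) (K x) < ?e" if "continuous_on S K" for K :: "real^2 \<Rightarrow> real"
    using that e x unfolding continuous_on_iff by blast
  obtain d1 d2 where d: "d1 > 0" "d2 > 0"
    "\<And>y. y \<in> S \<Longrightarrow> dist y x < d1 \<Longrightarrow> dist (F y) (F x) < ?e"
    "\<And>y. y \<in> S \<Longrightarrow> dist y x < d2 \<Longrightarrow> dist (G y) (G x) < ?e"
    using near[of F] near[of G] C1(2)[of i] C1(2)[of j] unfolding C1_on_def F_def G_def by blast
  obtain r where r: "r > 0" "ball x r \<subseteq> S" using S x open_contains_ball by blast
  \<comment> \<open>Points of the square of side \<open>h\<close> lie within \<open>2 * h\<close> of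
    \<open>x\<close>, so a third of the minimum keeps them in \<open>S\<close> and in both
    continuity neighbourhoods.\<close>
  define h where "h = Min {r, d1, d2} / 3"
  have h: "h > 0" "3 * h \<le> r" "3 * h \<le> d1" "3 * h \<le> d2" using r d by (auto simp: h_def)
  have close: "dist (x + s *\<^sub>R axis k 1 + t *\<^sub>R axis m 1) x < 3 * h"
    if "0 \<le> s" "s \<le> h" "0 \<le> t" "t \<le> h" for s t k m
  proof -
    have "norm (s *\<^sub>R axis k 1 + t *\<^sub>R axis m (1::real)) \<le> \<bar>s\<bar> + \<bar>t\<bar>"
      using norm_triangle_ineq[of "s *\<^sub>R axis k 1" "t *\<^sub>R axis m (1::real)"] by (simp add: norm_axis_1)
    then show ?thesis using that h by (simp add: dist_norm add.assoc)
  qed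
  have inS: "x + s *\<^sub>R axis k 1 + t *\<^sub>R axis m 1 \<in> S"
    if "0 \<le> s" "s \<le> h" "0 \<le> t" "t \<le> h" for s t k m
    using close[OF that, of k m] r h by (auto simp: dist_commute subset_iff)
  obtain s t where st: "0 \<le> s" "s \<le> h" "0 \<le> t" "t \<le> h"
    "u (x + h *\<^sub>R axis i 1 + h *\<^sub>R axis j 1) - u (x + h *\<^sub>R axis i 1) - u (x + h *\<^sub>R axis j 1) + u x
      = h\<^sup>2 * F (x + s *\<^sub>R axis i 1 + t *\<^sub>R axis j 1)"
    unfolding F_def by (rule second_difference_mixed[OF C1(1) C1(2)[of i] h(1)], rule inS)
  obtain s' t' where st': "0 \<le> s'" "s' \<le> h" "0 \<le> t'" "t' \<le> h"
    "u (x + h *\<^sub>R axis j 1 + h *\<^sub>R axis i 1) - u (x + h *\<^sub>R axis j 1) - u (x + h *\<^sub>R axis i 1) + u x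
      = h\<^sup>2 * G (x + s' *\<^sub>R axis j 1 + t' *\<^sub>R axis i 1)"
    unfolding G_def by (rule second_difference_mixed[OF C1(1) C1(2)[of j] h(1)], rule inS)
  have "h\<^sup>2 * F (x + s *\<^sub>R axis i 1 + t *\<^sub>R axis j 1) = h\<^sup>2 * G (x + s' *\<^sub>R axis j 1 + t' *\<^sub>R axis i 1)"
    using st(5) st'(5) by (simp add: algebra_simps)
  then have "F (x + s *\<^sub>R axis i 1 + t *\<^sub>R axis j 1) = G (x + s' *\<^sub>R axis j 1 + t' *\<^sub>R axis i 1)"
    using h by simp
  moreover have "dist (F (x + s *\<^sub>R axis i 1 + t *\<^sub>R axis j 1)) (F x) < ?e"
    using st(1-4) close[OF st(1-4), of i j] h by (intro d inS) auto
  moreover have "dist (G (x + s' *\<^sub>R axis j 1 + t' *\<^sub>R axis i 1)) (G x) < ?e"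
    using st'(1-4) close[OF st'(1-4), of j i] h by (intro d inS) auto
  ultimately show False using dist_triangle_half_r by (metis dist_real_def less_irrefl)
qed

section \<open>Gradient, Hessian and touching planes\<close>

definition grad :: "(real^2 \<Rightarrow> real) \<Rightarrow> real^2 \<Rightarrow> real^2" where
  "grad u x = (\<chi> i. partial_deriv i u x)"

text \<open>Row \<open>i\<close> is the gradient of \<open>partial_deriv i u\<close>, so the matrix
  is the Jacobian of \<open>grad u\<close>. Symmetry comes separately from
  \<open>partial_deriv_commute\<close>.\<close>

definition hess :: "(real^2 \<Rightarrow> real) \<Rightarrow> real^2 \<Rightarrow> real^2^2" where
  "hess u x = (\<chi> i j. partial_deriv j (partial_deriv i u) x)"

lemma has_derivative_grad_inner:
  assumes "open S" "C1_on S u" "x \<in> S"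
  shows "(u has_derivative (\<lambda>h. grad u x \<bullet> h)) (at x)"
  using C1_on_has_derivative[OF assms] by (simp add: grad_def inner_vec_def sum_2 mult.commute)

lemma has_derivative_hess:
  assumes "open S" "C2_on S u" "x \<in> S"
  shows "(grad u has_derivative (\<lambda>h. hess u x *v h)) (at x)"
proof -
  have "((\<lambda>x. partial_deriv i u x) has_derivative (\<lambda>h. grad (partial_deriv i u) x \<bullet> h)) (at x)" for i
    using assms by (intro has_derivative_grad_inner) (auto simp: C2_on_def)
  moreover have "grad (partial_deriv i u) x \<bullet> h = (hess u x *v h) $ i" for i h
    by (simp add: grad_def hess_def matrix_vector_mult_def inner_vec_def)
  ultimately have "((\<lambda>x. grad u x $ i) has_derivative (\<lambda>h. (hess u x *v h) $ i)) (at x)" for i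
    by (simp add: grad_def)
  then show ?thesis
    unfolding has_derivative_componentwise_within[of "grad u"]
    by (auto simp: Basis_vec_def inner_axis)
qed

text \<open>\<open>u\<close> minus the plane has a minimum at \<open>y\<close>, so its gradient
  vanishes there. A direction of negative curvature would make it strictly decrease along a short
  ray from \<open>y\<close>.\<close>

lemma touching_plane:
  assumes S: "open S" and u: "C2_on S u" and y: "y \<in> S"
    and le: "\<And>x. x \<in> S \<Longrightarrow> u y + p \<bullet> (x - y) \<le> u x"
  shows "grad u y = p" "0 \<le> \<xi> \<bullet> (hess u y *v \<xi>)"
proof -
  have C1: "C1_on S u" using u by (simp add: C2_on_def)
  have "((\<lambda>x. u x - p \<bullet> x) has_derivative (\<lambda>h. grad u y \<bullet> h - p \<bullet> h)) (at y)"
    by (intro derivative_intros has_derivative_grad_inner[OF S C1 y])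
  then have "(\<lambda>h. grad u y \<bullet> h - p \<bullet> h) = (\<lambda>v. 0)"
    using le by (intro differential_zero_maxmin[OF y S]) (auto simp: inner_diff_right algebra_simps)
  then have "grad u y \<bullet> h - p \<bullet> h = 0" for h by (rule fun_cong)
  then have "(grad u y - p) \<bullet> (grad u y - p) = 0" unfolding inner_diff_left .
  then show p: "grad u y = p" by simp
  show "0 \<le> \<xi> \<bullet> (hess u y *v \<xi>)"
  proof (rule ccontr)
    assume neg: "\<not> 0 \<le> \<xi> \<bullet> (hess u y *v \<xi>)"
    \<comment> \<open>Up to a constant, \<open>g\<close> is \<open>u\<close> minus the plane along
      the ray in direction \<open>\<xi>\<close>, and \<open>k\<close> is its derivative.
      \<open>k\<close> vanishes at 0 and has there the derivative
      \<open>\<xi> \<bullet> (hess u y *v \<xi>)\<close>, assumed negative.\<close>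
    define k where "k = (\<lambda>t::real. grad u (y + t *\<^sub>R \<xi>) \<bullet> \<xi> - p \<bullet> \<xi>)"
    define g where "g = (\<lambda>t::real. u (y + t *\<^sub>R \<xi>) - t * (p \<bullet> \<xi>))"
    have line: "((\<lambda>t::real. y + t *\<^sub>R \<xi>) has_derivative (\<lambda>t. t *\<^sub>R \<xi>)) (at s)" for s
      by (auto intro!: derivative_eq_intros)
    have "((\<lambda>t. grad u (y + t *\<^sub>R \<xi>)) has_derivative (\<lambda>t. hess u y *v (t *\<^sub>R \<xi>))) (at 0)"
      using has_derivative_compose[OF line[of 0], of "grad u"] has_derivative_hess[OF S u y] by simp
    from has_derivative_diff[OF has_derivative_inner_left[OF this] has_derivative_const]
    have "(k has_derivative (\<lambda>t. (hess u y *v (t *\<^sub>R \<xi>)) \<bullet> \<xi>)) (at 0)"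
      unfolding k_def by simp
    moreover have "(hess u y *v (t *\<^sub>R \<xi>)) \<bullet> \<xi> = (\<xi> \<bullet> (hess u y *v \<xi>)) * t" for t
      by (simp add: matrix_vector_mult_scaleR inner_commute)
    ultimately have "(k has_real_derivative \<xi> \<bullet> (hess u y *v \<xi>)) (at 0)"
      by (simp add: has_field_derivative_def)
    from DERIV_neg_dec_right[OF this] neg obtain d where d: "d > 0" "\<And>h. 0 < h \<Longrightarrow> h < d \<Longrightarrow> k h < k 0"
      by auto
    have "open ((\<lambda>t. y + t *\<^sub>R \<xi>) -` S)"
      by (intro open_vimage S continuous_intros)
    moreover have "0 \<in> (\<lambda>t::real. y + t *\<^sub>R \<xi>) -` S" using y by simp
    ultimately obtain r where r: "r > 0" and "ball 0 r \<subseteq> (\<lambda>t. y + t *\<^sub>R \<xi>) -` S"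
      using open_contains_ball by blast
    then have rS: "y + t *\<^sub>R \<xi> \<in> S" if "\<bar>t\<bar> < r" for t
      using that by (auto simp: subset_iff)
    define h where "h = min d r / 2"
    have h: "0 < h" "h < d" "h < r" using d r by (auto simp: h_def)
    have "(g has_real_derivative k t) (at t)" if "0 \<le> t" "t \<le> h" for t
    proof -
      have "y + t *\<^sub>R \<xi> \<in> S" using that h rS[of t] by auto
      from has_derivative_compose[OF line has_derivative_grad_inner[OF S C1 this]]
      have "(g has_derivative (\<lambda>s. grad u (y + t *\<^sub>R \<xi>) \<bullet> (s *\<^sub>R \<xi>) - s * (p \<bullet> \<xi>))) (at t)"
        unfolding g_def by (intro has_derivative_diff has_derivative_mult_left has_derivative_ident)
      moreover have "grad u (y + t *\<^sub>R \<xi>) \<bullet> (s *\<^sub>R \<xi>) - s * (p \<bullet> \<xi>) = k t * s" for s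
        by (simp add: k_def algebra_simps)
      ultimately show ?thesis by (simp add: has_field_derivative_def)
    qed
    from MVT2[OF h(1) this] obtain t where t: "0 < t" "t < h" "g h - g 0 = h * k t" by auto
    have "k 0 = 0" by (simp add: k_def p)
    with d(2)[of t] t h have "k t < 0" by auto
    with t h have "g h < g 0" by (metis diff_less_0_iff_less mult_pos_neg)
    moreover have "g 0 \<le> g h" using le[of "y + h *\<^sub>R \<xi>"] rS[of h] h by (simp add: g_def)
    ultimately show False by simp
  qed
qed

section \<open>Convex envelopes and contact points\<close>

lemma affine_le_convex_envelope:
  assumes "\<And>y. y \<in> D \<Longrightarrow> p \<bullet> y + c \<le> w y" "x \<in> D"
  shows "p \<bullet> x + c \<le> convex_envelope D w x"
  unfolding convex_envelope_def
proof (rule cSup_upper)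
  show "p \<bullet> x + c \<in> {p \<bullet> x + c |p c. \<forall>y\<in>D. p \<bullet> y + c \<le> w y}" using assms(1) by blast
  \<comment> \<open>Since \<open>x\<close> lies in \<open>D\<close>, the value \<open>w x\<close>
    bounds all admissible affine functions at \<open>x\<close>.\<close>
  show "bdd_above {p \<bullet> x + c |p c. \<forall>y\<in>D. p \<bullet> y + c \<le> w y}"
    using assms(2) by (auto intro!: bdd_aboveI[of _ "w x"])
qed

text \<open>The lower bound \<open>K\<close> makes the constant \<open>K\<close> an admissible
  affine function, so the real \<open>Sup\<close> is taken over a nonempty set.\<close>

lemma convex_envelope_least:
  assumes "\<And>p c. \<forall>y\<in>D. p \<bullet> y + c \<le> w y \<Longrightarrow> p \<bullet> x + c \<le> b"
    and "\<And>y. y \<in> D \<Longrightarrow> K \<le> w y"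
  shows "convex_envelope D w x \<le> b"
  unfolding convex_envelope_def
proof (rule cSup_least)
  have "0 \<bullet> x + K \<in> {p \<bullet> x + c |p c. \<forall>y\<in>D. p \<bullet> y + c \<le> w y}"
    using assms(2) by fastforce
  then show "{p \<bullet> x + c |p c. \<forall>y\<in>D. p \<bullet> y + c \<le> w y} \<noteq> {}" by blast
qed (use assms(1) in auto)

text \<open>Convexity will give continuity of the envelope. An affine minorant splits exactly over a
  convex combination and lies below the envelope at both end points.\<close>

lemma convex_on_convex_envelope:
  assumes D: "convex D" and K: "\<And>y. y \<in> D \<Longrightarrow> K \<le> w y"
  shows "convex_on D (convex_envelope D w)"
proof (rule convex_onI)
  fix t :: real and x y assume t: "0 < t" "t < 1" and xy: "x \<in> D" "y \<in> D"
  show "convex_envelope D w ((1 - t) *\<^sub>R x + t *\<^sub>R y)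
      \<le> (1 - t) * convex_envelope D w x + t * convex_envelope D w y"
  proof (rule convex_envelope_least[OF _ K])
    fix p c assume le: "\<forall>y\<in>D. p \<bullet> y + c \<le> w y"
    have "p \<bullet> ((1 - t) *\<^sub>R x + t *\<^sub>R y) + c = (1 - t) * (p \<bullet> x + c) + t * (p \<bullet> y + c)"
      by (simp add: inner_add_right algebra_simps)
    also have "\<dots> \<le> (1 - t) * convex_envelope D w x + t * convex_envelope D w y"
      using le xy t by (intro add_mono mult_left_mono affine_le_convex_envelope) auto
    finally show "p \<bullet> ((1 - t) *\<^sub>R x + t *\<^sub>R y) + c
      \<le> (1 - t) * convex_envelope D w x + t * convex_envelope D w y" .
  qed
qed (rule D)

text \<open>Sliding a plane of small slope upwards until it meets the graph of \<open>u\<close>.\<close>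

lemma exists_contact_point:
  fixes u :: "'a::euclidean_space \<Rightarrow> real"
  assumes \<Omega>: "open \<Omega>" "bounded \<Omega>" and u: "continuous_on (closure \<Omega>) u"
    and bd: "\<And>x. x \<in> frontier \<Omega> \<Longrightarrow> 0 \<le> u x"
    and x0: "x0 \<in> \<Omega>"
    and sub: "closure \<Omega> \<subseteq> cball x0 r" "D \<subseteq> cball x0 r"
    and p: "norm p * r < - u x0"
  obtains y where "y \<in> \<Omega>" "u y < 0"
    "\<And>x. x \<in> D \<Longrightarrow> u y + p \<bullet> (x - y) \<le> - neg_part (zero_extension \<Omega> u) x"
proof -
  \<comment> \<open>The plane of slope \<open>p\<close> through the graph point over
    \<open>x0\<close> rises by at most \<open>norm p * r\<close> on the ball, too little to reach
    height 0.\<close>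
  have slope: "u x0 + p \<bullet> (x - x0) < 0" if "x \<in> cball x0 r" for x
  proof -
    have "p \<bullet> (x - x0) \<le> norm p * norm (x - x0)" by (rule norm_cauchy_schwarz)
    also have "\<dots> \<le> norm p * r"
      using that by (intro mult_left_mono) (auto simp: dist_norm norm_minus_commute)
    finally show ?thesis using p by simp
  qed
  have "compact (closure \<Omega>)" using \<Omega> by (simp add: compact_closure)
  moreover have "closure \<Omega> \<noteq> {}" using x0 by auto
  moreover have "continuous_on (closure \<Omega>) (\<lambda>x. u x - p \<bullet> x)"
    by (intro continuous_intros u)
  ultimately have "\<exists>y\<in>closure \<Omega>. \<forall>x\<in>closure \<Omega>. u y - p \<bullet> y \<le> u x - p \<bullet> x"
    by (rule continuous_attains_inf)
  then obtain y where y: "y \<in> closure \<Omega>"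
    and y_min: "\<And>x. x \<in> closure \<Omega> \<Longrightarrow> u y - p \<bullet> y \<le> u x - p \<bullet> x"
    by blast
  have x0_cl: "x0 \<in> closure \<Omega>" using x0 closure_subset by blast
  \<comment> \<open>By minimality the plane through the graph point over \<open>y\<close> lies
    nowhere above the one over \<open>x0\<close>, hence is negative on the ball. This makes
    \<open>u y\<close> negative, so \<open>y\<close> is off the frontier.\<close>
  have "u y < 0"
    using y_min[OF x0_cl] slope[of y] y sub(1) by (auto simp: inner_diff_right)
  then have "y \<in> \<Omega>"
    using bd[of y] y \<Omega>(1) by (force simp: frontier_def interior_open)
  moreover have "u y + p \<bullet> (x - y) \<le> - neg_part (zero_extension \<Omega> u) x" if "x \<in> D" for x
  proof (cases "x \<in> \<Omega> \<and> u x < 0")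
    case True
    then have "x \<in> closure \<Omega>" using closure_subset by blast
    with True show ?thesis using y_min[of x]
      by (simp add: neg_part_def zero_extension_def inner_diff_right)
  next
    \<comment> \<open>Here the right-hand side is 0, and the plane is negative on
      \<open>D\<close>.\<close>
    case False
    then have "neg_part (zero_extension \<Omega> u) x = 0"
      by (auto simp: neg_part_def zero_extension_def)
    then show ?thesis
      using y_min[OF x0_cl] slope[of x] that sub(2) by (auto simp: inner_diff_right)
  qed
  ultimately show ?thesis using \<open>u y < 0\<close> that by blast
qed

section \<open>The determinant bound and its integral\<close>

lemma sq_le_prod_of_quadratic_nonneg:
  fixes a b c :: real
  assumes "\<And>s t. 0 \<le> a * s\<^sup>2 + 2 * b * s * t + c * t\<^sup>2"
  shows "0 \<le> a" "0 \<le> c" "b\<^sup>2 \<le> a * c"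
proof -
  show a: "0 \<le> a" using assms[of 1 0] by simp
  show c: "0 \<le> c" using assms[of 0 1] by simp
  show "b\<^sup>2 \<le> a * c"
  proof (cases "c = 0")
    case True
    have "b = 0"
    proof (rule ccontr)
      assume "b \<noteq> 0"
      \<comment> \<open>With \<open>c = 0\<close> and \<open>s = 1\<close> the form is linear in
        \<open>t\<close>; this \<open>t\<close> gives it the value -1.\<close>
      with assms[of 1 "- (a + 1) / (2 * b)"] True show False by simp
    qed
    with True show ?thesis by simp
  next
    case False
    with c have "c > 0" by simp
    \<comment> \<open>The form evaluated at \<open>s = c\<close>, \<open>t = - b\<close>, where it
      is \<open>c\<close> times the determinant.\<close>
    have "0 \<le> a * c\<^sup>2 + 2 * b * c * (- b) + c * (- b)\<^sup>2" by (rule assms)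
    also have "\<dots> = c * (a * c - b\<^sup>2)" by (simp add: algebra_simps power2_eq_square)
    finally show ?thesis using \<open>c > 0\<close> by (simp add: zero_le_mult_iff)
  qed
qed

text \<open>This is the trace of a product of two positive semidefinite symmetric matrices. The
  determinant conditions bound the mixed term by twice the geometric mean of the diagonal terms,
  hence by their sum; squaring avoids roots.\<close>

lemma trace_prod_nonneg:
  fixes a b c :: real
  assumes "0 \<le> a" "0 \<le> c" "b\<^sup>2 \<le> a * c" "0 \<le> a'" "0 \<le> c'" "b'\<^sup>2 \<le> a' * c'"
  shows "0 \<le> a * a' + 2 * b * b' + c * c'"
proof -
  have "(b * b')\<^sup>2 \<le> (a * c) * (a' * c')"
    unfolding power_mult_distrib using assms by (intro mult_mono) auto
  then have "(2 * b * b')\<^sup>2 \<le> 4 * ((a * a') * (c * c'))" by (simp add: power_mult_distrib algebra_simps)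
  also have "\<dots> \<le> (a * a' + c * c')\<^sup>2"
    using zero_le_power2[of "a * a' - c * c'"] by (simp add: power2_eq_square algebra_simps)
  finally have "(2 * b * b')\<^sup>2 \<le> (a * a' + c * c')\<^sup>2" .
  moreover have "0 \<le> a * a' + c * c'" using assms by simp
  ultimately have "\<bar>2 * b * b'\<bar> \<le> a * a' + c * c'"
    by (metis abs_le_square_iff abs_of_nonneg)
  then show ?thesis by linarith
qed

text \<open>Subtracting \<open>l\<close> times the identity from the coefficient matrix leaves a
  positive semidefinite one, so \<open>l\<close> times the trace of \<open>w\<close> is at most
  \<open>m\<close>. The arithmetic-geometric mean inequality bounds four times the determinant by
  the squared trace.\<close>

lemma det_le_trace_sq:
  fixes l :: real
  assumes l: "0 < l"
    and ell: "\<And>s t. l * (s\<^sup>2 + t\<^sup>2) \<le> a * s\<^sup>2 + 2 * b * s * t + c * t\<^sup>2"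
    and w: "0 \<le> w11" "0 \<le> w22" "w12\<^sup>2 \<le> w11 * w22"
    and tr: "a * w11 + 2 * b * w12 + c * w22 \<le> m"
  shows "4 * l\<^sup>2 * (w11 * w22 - w12\<^sup>2) \<le> (max m 0)\<^sup>2"
proof -
  have "0 \<le> (a - l) * s\<^sup>2 + 2 * b * s * t + (c - l) * t\<^sup>2" for s t
    using ell[of s t] by (simp add: algebra_simps)
  from trace_prod_nonneg[OF sq_le_prod_of_quadratic_nonneg[OF this] w]
  have "0 \<le> (a - l) * w11 + 2 * b * w12 + (c - l) * w22" .
  with tr have "l * (w11 + w22) \<le> max m 0" by (simp add: algebra_simps)
  then have "(l * (w11 + w22))\<^sup>2 \<le> (max m 0)\<^sup>2" using l w by (intro power_mono) auto
  moreover have "4 * (w11 * w22) \<le> (w11 + w22)\<^sup>2"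
    using zero_le_power2[of "w11 - w22"] by (simp add: power2_eq_square algebra_simps)
  then have "4 * (w11 * w22 - w12\<^sup>2) \<le> (w11 + w22)\<^sup>2"
    using zero_le_power2[of w12] unfolding right_diff_distrib by linarith
  then have "l\<^sup>2 * (4 * (w11 * w22 - w12\<^sup>2)) \<le> l\<^sup>2 * (w11 + w22)\<^sup>2"
    by (intro mult_left_mono) auto
  moreover have "l\<^sup>2 * (w11 + w22)\<^sup>2 = (l * (w11 + w22))\<^sup>2" by (simp add: power_mult_distrib)
  ultimately show ?thesis by (simp only: mult.assoc mult.left_commute[of _ 4])
qed

text \<open>Since \<open>x $ 1\<close> is constant in direction 2, \<open>X2 (X1 u)\<close> and
  \<open>X2 (X2 u)\<close> have no first-order terms. The operator is thus the trace of the
  coefficient matrix against the Hessian with second row and column scaled by \<open>x $ 1\<close>,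
  and \<open>det_le_trace_sq\<close> applies to that matrix. Cancelling
  \<open>(x $ 1)\<^sup>2\<close> requires \<open>x $ 1\<close> to be nonzero.\<close>

lemma det_hess_le:
  assumes l: "0 < l" and ell: "ellipticity_constants l L a11 a12 a22"
    and \<Omega>: "open \<Omega>" and u: "C2_on \<Omega> u" and x: "x \<in> \<Omega>"
    and psd: "0 \<le> hess u x $ 1 $ 1" "0 \<le> hess u x $ 2 $ 2" "0 \<le> det (hess u x)"
    and Lu: "grushin_op a11 a12 a22 u x \<le> f x * (x $ 1)\<^sup>2" and x1: "x $ 1 \<noteq> 0"
  shows "det (hess u x) \<le> (pos_part f x)\<^sup>2 * (x $ 1)\<^sup>2 / (4 * l\<^sup>2)"
proof -
  let ?U = "\<lambda>i j. hess u x $ i $ j"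
  have sym: "?U 2 1 = ?U 1 2"
    using partial_deriv_commute[OF \<Omega> u x] by (simp add: hess_def)
  have det: "det (hess u x) = ?U 1 1 * ?U 2 2 - (?U 1 2)\<^sup>2"
    by (simp add: det_2 sym power2_eq_square)
  have X1: "X1 v = partial_deriv 1 v" for v by (simp add: X1_def fun_eq_iff)
  have "a11 x * ?U 1 1 + 2 * a12 x * (x $ 1 * ?U 1 2) + a22 x * ((x $ 1)\<^sup>2 * ?U 2 2) \<le> f x * (x $ 1)\<^sup>2"
    using Lu X2_X2[OF u x] by (simp add: grushin_op_def X1 hess_def X2_def[of "partial_deriv 1 u"])
  moreover have "l * (s\<^sup>2 + t\<^sup>2) \<le> a11 x * s\<^sup>2 + 2 * a12 x * s * t + a22 x * t\<^sup>2" for s t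
  proof -
    have "\<exists>\<xi>::real^2. \<xi> $ 1 = s \<and> \<xi> $ 2 = t"
      by (rule exI[of _ "vector [s, t]"]) simp
    then show ?thesis using ell unfolding ellipticity_constants_def by metis
  qed
  moreover have "(x $ 1 * ?U 1 2)\<^sup>2 \<le> ?U 1 1 * ((x $ 1)\<^sup>2 * ?U 2 2)"
  proof -
    have "(x $ 1)\<^sup>2 * (?U 1 2)\<^sup>2 \<le> (x $ 1)\<^sup>2 * (?U 1 1 * ?U 2 2)"
      using psd(3) det by (intro mult_left_mono) auto
    then show ?thesis by (simp add: power_mult_distrib algebra_simps)
  qed
  ultimately have "4 * l\<^sup>2 * (?U 1 1 * ((x $ 1)\<^sup>2 * ?U 2 2) - (x $ 1 * ?U 1 2)\<^sup>2) \<le> (max (f x * (x $ 1)\<^sup>2) 0)\<^sup>2"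
    using psd by (intro det_le_trace_sq[OF l]) auto
  also have "max (f x * (x $ 1)\<^sup>2) 0 = pos_part f x * (x $ 1)\<^sup>2"
    by (auto simp: pos_part_def max_def mult_le_0_iff zero_le_mult_iff)
  finally have "(x $ 1)\<^sup>2 * (det (hess u x) * (4 * l\<^sup>2)) \<le> (x $ 1)\<^sup>2 * ((pos_part f x)\<^sup>2 * (x $ 1)\<^sup>2)"
    by (simp add: det algebra_simps power2_eq_square)
  then have "det (hess u x) * (4 * l\<^sup>2) \<le> (pos_part f x)\<^sup>2 * (x $ 1)\<^sup>2"
    using x1 by (subst (asm) mult_le_cancel_left_pos) auto
  then show ?thesis using l by (subst pos_le_divide_eq) auto
qed

text \<open>The area of the image is at most the integral over \<open>A\<close> of the absolute
  Jacobian determinant of \<open>grad u\<close>. On \<open>A\<close> the Hessian is positive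
  semidefinite, so the pointwise bound applies; its nonnegative right-hand side is then integrated
  over the larger \<open>S\<close>.\<close>

lemma contact_det_integral_bound:
  fixes f :: "real^2 \<Rightarrow> real"
  assumes l: "0 < l" and ell: "ellipticity_constants l L a11 a12 a22"
    and \<Omega>: "open \<Omega>" "bounded \<Omega>" and u: "C2_on \<Omega> u"
    and f: "f \<in> borel_measurable (lebesgue_on \<Omega>)" "bounded (f ` \<Omega>)"
    and Lu: "\<And>x. x \<in> \<Omega> \<Longrightarrow> grushin_op a11 a12 a22 u x \<le> f x * (x $ 1)\<^sup>2"
    and S: "S \<in> sets lebesgue" "S \<subseteq> \<Omega>"
  defines "A \<equiv> {x \<in> S. 0 \<le> hess u x $ 1 $ 1 \<and> 0 \<le> hess u x $ 2 $ 2 \<and> 0 \<le> det (hess u x)}"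
  shows "grad u ` A \<in> lmeasurable"
    and "measure lebesgue (grad u ` A)
      \<le> (LINT x|lebesgue_on S. (pos_part f x)\<^sup>2 * (x $ 1)\<^sup>2) / (4 * l\<^sup>2)"
proof -
  define F where "F = (\<lambda>x. (pos_part f x)\<^sup>2 * (x $ 1)\<^sup>2)"
  define J where "J = (\<lambda>x. det (hess u x))"
  \<comment> \<open>Setting the value to 0 on the degenerate line makes the bound by
    \<open>F x / (4 * l\<^sup>2)\<close> hold on all of \<open>A\<close>.\<close>
  define J0 where "J0 = (\<lambda>x::real^2. if x $ 1 = 0 then 0 else J x)"
  have \<Omega>_meas: "\<Omega> \<in> sets lebesgue" using \<Omega> by (simp add: lmeasurable_open fmeasurableD)
  have cont_hess: "continuous_on \<Omega> (\<lambda>x. hess u x $ i $ j)" for i j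
    using u by (simp add: C2_on_def C1_on_def hess_def)
  have "J = (\<lambda>x. hess u x $ 1 $ 1 * hess u x $ 2 $ 2 - hess u x $ 1 $ 2 * hess u x $ 2 $ 1)"
    by (simp add: J_def det_2 fun_eq_iff)
  then have cont_J: "continuous_on \<Omega> J"
    by (simp only:) (intro continuous_on_diff continuous_on_mult cont_hess)
  have vim: "\<Omega> \<inter> g -` {0..} \<in> sets lebesgue" if g: "continuous_on \<Omega> g" for g :: "real^2 \<Rightarrow> real"
  proof -
    obtain T where "closed T" "\<Omega> \<inter> g -` {0..} = \<Omega> \<inter> T"
      using continuous_closedin_preimage[OF g, of "{0..}"] by (auto simp: closedin_closed)
    then show ?thesis using \<Omega>_meas by auto
  qed
  have "A = S \<inter> (\<Omega> \<inter> (\<lambda>x. hess u x $ 1 $ 1) -` {0..})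
      \<inter> (\<Omega> \<inter> (\<lambda>x. hess u x $ 2 $ 2) -` {0..}) \<inter> (\<Omega> \<inter> J -` {0..})"
    using S(2) by (auto simp: A_def J_def)
  also have "\<dots> \<in> sets lebesgue" by (intro sets.Int S vim cont_hess cont_J)
  finally have A: "A \<in> sets lebesgue" .
  have AS: "A \<subseteq> S" "A \<subseteq> \<Omega>" using S(2) by (auto simp: A_def)
  \<comment> \<open>Bounds on \<open>f\<close> and \<open>\<Omega>\<close> make \<open>F\<close>
    integrable. This matters because the Bochner integral of a nonintegrable function is 0 by
    convention.\<close>
  obtain B where B: "\<And>x. x \<in> \<Omega> \<Longrightarrow> \<bar>f x\<bar> \<le> B" using f(2) by (auto simp: bounded_iff)
  obtain R where R: "\<And>x. x \<in> \<Omega> \<Longrightarrow> norm x \<le> R" using \<Omega>(2) by (auto simp: bounded_iff)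
  have F0: "0 \<le> F x" for x by (simp add: F_def)
  have F_bound: "F x \<le> B\<^sup>2 * R\<^sup>2" if "x \<in> \<Omega>" for x
  proof -
    have "(pos_part f x)\<^sup>2 \<le> B\<^sup>2"
      using B[OF that] by (intro power_mono) (auto simp: pos_part_def)
    moreover have "\<bar>x $ 1\<bar> \<le> R" using R[OF that] component_le_norm_cart[of x 1] by linarith
    then have "(x $ 1)\<^sup>2 \<le> R\<^sup>2" by (metis abs_ge_zero power2_abs power_mono)
    ultimately show ?thesis unfolding F_def by (intro mult_mono) auto
  qed
  have x1_meas: "(\<lambda>x::real^2. x $ 1) \<in> borel_measurable (lebesgue_on T)" if "T \<in> sets lebesgue" for T
    using that by (intro continuous_imp_measurable_on_sets_lebesgue continuous_intros)
  have F_int: "integrable (lebesgue_on T) F" if T: "T \<in> sets lebesgue" "T \<subseteq> \<Omega>" for T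
  proof -
    have "T \<in> lmeasurable" using T \<Omega>(2) by (auto intro: bounded_set_imp_lmeasurable bounded_subset)
    then interpret finite_measure "lebesgue_on T" by (rule finite_measure_lebesgue_on)
    note [measurable] = x1_meas[OF T(1)] measurable_restrict_mono[OF f(1) T(2)]
    have "F \<in> borel_measurable (lebesgue_on T)" unfolding F_def pos_part_def by measurable
    then show ?thesis
      using F0 F_bound T by (intro integrable_const_bound[of _ "B\<^sup>2 * R\<^sup>2"] AE_I2) auto
  qed
  note FS = F_int[OF S] and FA = F_int[OF A AS(2)]
  have FA_div: "integrable (lebesgue_on A) (\<lambda>x. F x / (4 * l\<^sup>2))" using FA by simp
  have J0_le: "0 \<le> J0 x" "J0 x \<le> F x / (4 * l\<^sup>2)" if "x \<in> A" for x
    using that det_hess_le[OF l ell \<Omega>(1) u, of x f] Lu[of x] AS F0[of x] l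
    by (auto simp: J0_def J_def F_def A_def)
  have "J \<in> borel_measurable (lebesgue_on A)"
    using cont_J AS A by (intro continuous_imp_measurable_on_sets_lebesgue) (auto intro: continuous_on_subset)
  then have "J0 \<in> borel_measurable (lebesgue_on A)"
    unfolding J0_def using x1_meas[OF A] by measurable
  then have J0_int: "integrable (lebesgue_on A) J0"
    by (rule Bochner_Integration.integrable_bound[OF FA_div])
      (use J0_le in \<open>auto intro!: AE_I2 simp: abs_of_nonneg F0\<close>)
  \<comment> \<open>On the line \<open>x $ 1 = 0\<close> the operator does not control the Hessian determinant; the line is discarded as a null set.\<close>
  have neg: "negligible {x::real^2. x $ 1 = 0}" by (rule negligible_standard_hyperplane_cart)
  \<comment> \<open>The image measure theorems speak of the Henstock-Kurzweil integral, so the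
    Lebesgue integral of \<open>J0\<close> is carried over and the integrand then changed on the
    null line.\<close>
  have "J0 integrable_on A" "integral A J0 = (LINT x|lebesgue_on A. J0 x)"
    using integrable_on_lebesgue_on[OF J0_int A] lebesgue_integral_eq_integral[OF J0_int A] by simp_all
  then have "(J0 has_integral (LINT x|lebesgue_on A. J0 x)) A" by (metis integrable_integral)
  then have "((\<lambda>x. \<bar>J x\<bar>) has_integral (LINT x|lebesgue_on A. J0 x)) A"
    by (rule has_integral_spike[OF neg, rotated]) (simp add: J0_def J_def A_def)
  then have J_int: "(\<lambda>x. \<bar>J x\<bar>) integrable_on A" "integral A (\<lambda>x. \<bar>J x\<bar>) = (LINT x|lebesgue_on A. J0 x)"
    by (auto simp: has_integral_iff)
  have deriv: "(grad u has_derivative (\<lambda>h. hess u x *v h)) (at x within A)" if "x \<in> A" for x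
    using has_derivative_hess[OF \<Omega>(1) u] that AS by (auto intro: has_derivative_at_withinI)
  have J_det: "(\<lambda>x. \<bar>det (matrix ((*v) (hess u x)))\<bar>) = (\<lambda>x. \<bar>J x\<bar>)" by (simp add: J_def)
  show "grad u ` A \<in> lmeasurable"
    using measurable_differentiable_image[OF A deriv] J_int J_det by simp
  have "measure lebesgue (grad u ` A) \<le> (LINT x|lebesgue_on A. J0 x)"
    using measure_differentiable_image[OF A deriv] J_int J_det by simp
  also have "\<dots> \<le> (LINT x|lebesgue_on A. F x / (4 * l\<^sup>2))"
    using J0_le by (intro integral_mono J0_int FA_div) auto
  also have "\<dots> = (LINT x|lebesgue_on A. F x) / (4 * l\<^sup>2)" by simp
  also have "\<dots> \<le> (LINT x|lebesgue_on S. F x) / (4 * l\<^sup>2)"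
  proof (rule divide_right_mono)
    show "(LINT x|lebesgue_on A. F x) \<le> (LINT x|lebesgue_on S. F x)"
      using integral_subset_le[OF AS(1) integrable_on_lebesgue_on[OF FA A] integrable_on_lebesgue_on[OF FS S(1)]] F0
      by (simp add: lebesgue_integral_eq_integral[OF FA A] lebesgue_integral_eq_integral[OF FS S(1)])
  qed simp
  finally show "measure lebesgue (grad u ` A) \<le> (LINT x|lebesgue_on S. (pos_part f x)\<^sup>2 * (x $ 1)\<^sup>2) / (4 * l\<^sup>2)"
    unfolding F_def .
qed

section \<open>Slopes attained on the contact set, and the final estimate\<close>

lemma ball_subset_grad_contact_set:
  assumes \<Omega>: "open \<Omega>" "bounded \<Omega>" and u: "continuous_on (closure \<Omega>) u" "C2_on \<Omega> u"
    and bd: "\<And>x. x \<in> frontier \<Omega> \<Longrightarrow> 0 \<le> u x"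
    and x0: "x0 \<in> \<Omega>" and sub: "closure \<Omega> \<subseteq> cball x0 r" "\<Omega> \<subseteq> D" "D \<subseteq> cball x0 r" and r: "r > 0"
  defines "w \<equiv> \<lambda>x. - neg_part (zero_extension \<Omega> u) x"
  defines "S \<equiv> \<Omega> \<inter> {x. u x = convex_envelope D w x}"
  shows "ball 0 (- u x0 / r)
    \<subseteq> grad u ` {x \<in> S. 0 \<le> hess u x $ 1 $ 1 \<and> 0 \<le> hess u x $ 2 $ 2 \<and> 0 \<le> det (hess u x)}"
proof
  fix p :: "real^2" assume "p \<in> ball 0 (- u x0 / r)"
  then have "norm p < - u x0 / r" by simp
  then have "norm p * r < - u x0" using r by (simp only: pos_less_divide_eq)
  from exists_contact_point[OF \<Omega> u(1) bd x0 sub(1,3) this]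
  obtain y where y: "y \<in> \<Omega>" "u y < 0" and le: "\<And>x. x \<in> D \<Longrightarrow> u y + p \<bullet> (x - y) \<le> w x"
    unfolding w_def by blast
  have yD: "y \<in> D" using y sub by blast
  have w_u: "w x \<le> u x" if "x \<in> \<Omega>" for x
    using that by (auto simp: w_def neg_part_def zero_extension_def)
  \<comment> \<open>The touching plane is itself an affine minorant of \<open>w\<close> with value
    \<open>u y\<close> at \<open>y\<close>, while any minorant is at most \<open>w y\<close>, hence
    at most \<open>u y\<close>.\<close>
  have "u y = convex_envelope D w y"
  proof (rule antisym)
    show "u y \<le> convex_envelope D w y"
      using affine_le_convex_envelope[of D p "u y - p \<bullet> y" w y] le yD
      by (simp add: inner_diff_right algebra_simps)
    have "p \<bullet> x + (u y - p \<bullet> y) \<le> w x" if "x \<in> D" for x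
      using le[OF that] by (simp add: inner_diff_right algebra_simps)
    then show "convex_envelope D w y \<le> u y"
      unfolding convex_envelope_def
      by (intro cSup_least) (use w_u[OF y(1)] yD in \<open>force+\<close>)
  qed
  then have yS: "y \<in> S" using y by (simp add: S_def)
  \<comment> \<open>Since \<open>w\<close> is at most \<open>u\<close> on \<open>\<Omega>\<close>,
    the plane also supports \<open>u\<close> from below, which gives the gradient and the sign of
    the Hessian.\<close>
  have touch: "u y + p \<bullet> (x - y) \<le> u x" if "x \<in> \<Omega>" for x
    using le[of x] w_u[OF that] that sub(2) by (meson order_trans subsetD)
  have grad: "grad u y = p" and psd: "0 \<le> \<xi> \<bullet> (hess u y *v \<xi>)" for \<xi>
    using touching_plane[OF \<Omega>(1) u(2) y(1) touch] by auto
  let ?U = "\<lambda>i j. hess u y $ i $ j"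
  have sym: "?U 2 1 = ?U 1 2"
    using partial_deriv_commute[OF \<Omega>(1) u(2) y(1)] by (simp add: hess_def)
  have "0 \<le> ?U 1 1 * s\<^sup>2 + 2 * ?U 1 2 * s * t + ?U 2 2 * t\<^sup>2" for s t
    using psd[of "vector [s, t]"] sym
    by (simp add: inner_vec_def matrix_vector_mult_def sum_2 algebra_simps power2_eq_square)
  from sq_le_prod_of_quadratic_nonneg[OF this]
  have "0 \<le> ?U 1 1" "0 \<le> ?U 2 2" "0 \<le> det (hess u y)"
    by (simp_all add: det_2 sym power2_eq_square)
  with yS grad show "p \<in> grad u ` {x \<in> S. 0 \<le> hess u x $ 1 $ 1 \<and> 0 \<le> hess u x $ 2 $ 2 \<and> 0 \<le> det (hess u x)}"
    by blast
qed

text \<open>A convex function on an open set in finite dimension is continuous, so the contact set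
  is relatively closed in \<open>\<Omega>\<close> and hence Borel.\<close>

lemma contact_set_measurable:
  fixes u :: "'a::euclidean_space \<Rightarrow> real"
  assumes \<Omega>: "open \<Omega>" "\<Omega> \<subseteq> D" and u: "continuous_on \<Omega> u"
    and D: "open D" "convex D" and K: "\<And>y. y \<in> D \<Longrightarrow> K \<le> w y"
  shows "\<Omega> \<inter> {x. u x = convex_envelope D w x} \<in> sets lebesgue"
proof -
  have "continuous_on D (convex_envelope D w)"
    by (intro convex_on_continuous D convex_on_convex_envelope) (rule K)
  then have "continuous_on \<Omega> (\<lambda>x. u x - convex_envelope D w x)"
    using u \<Omega>(2) by (intro continuous_on_diff) (auto intro: continuous_on_subset)
  from continuous_closedin_preimage[OF this, of "{0}"]
  obtain T where T: "closed T" "\<Omega> \<inter> (\<lambda>x. u x - convex_envelope D w x) -` {0} = \<Omega> \<inter> T"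
    by (auto simp: closedin_closed)
  have "\<Omega> \<inter> {x. u x = convex_envelope D w x} = \<Omega> \<inter> T"
    unfolding T(2)[symmetric] by auto
  also have "\<dots> \<in> sets borel" using \<Omega>(1) T(1) by (intro sets.Int borel_open borel_closed)
  finally show ?thesis by (rule sets_completionI_sets[of _ lborel, simplified])
qed

text \<open>With \<open>M = - u x0\<close>, comparing the area of the disc of slopes with the
  determinant integral \<open>I\<close> gives
  \<open>pi * (M / (4 * d))\<^sup>2 \<le> I / (4 * l\<^sup>2)\<close>. Solving for \<open>M\<close>
  produces the constant \<open>2 / (l * sqrt pi)\<close>.\<close>

lemma ABP_pointwise:
  assumes l: "0 < l" and ell: "ellipticity_constants l L a11 a12 a22"
    and \<Omega>: "open \<Omega>" "bounded \<Omega>" and u: "continuous_on (closure \<Omega>) u" "C2_on \<Omega> u"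
    and bd: "\<forall>x\<in>frontier \<Omega>. 0 \<le> u x"
    and f: "f \<in> borel_measurable (lebesgue_on \<Omega>)" "bounded (f ` \<Omega>)"
    and Lu: "\<forall>x\<in>\<Omega>. grushin_op a11 a12 a22 u x \<le> f x * (x $ 1)\<^sup>2"
    and sub: "\<Omega> \<subseteq> ball z (2 * diameter \<Omega>)"
    and \<Gamma>: "\<Gamma> = convex_envelope (ball z (2 * diameter \<Omega>)) (\<lambda>x. - neg_part (zero_extension \<Omega> u) x)"
    and x0: "x0 \<in> \<Omega>"
  shows "neg_part u x0 \<le> 2 / (l * sqrt pi) * diameter \<Omega> *
    sqrt (LINT x|lebesgue_on (\<Omega> \<inter> {x. u x = \<Gamma> x}). (pos_part f x)\<^sup>2 * (x $ 1)\<^sup>2)"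
proof (cases "u x0 < 0")
  case False
  then have "neg_part u x0 = 0" by (simp add: neg_part_def)
  moreover have "0 \<le> diameter \<Omega>" using \<Omega>(2) by (rule diameter_ge_0)
  ultimately show ?thesis using l by (auto intro!: mult_nonneg_nonneg Bochner_Integration.integral_nonneg)
next
  case True
  define d where "d = diameter \<Omega>"
  define D where "D = ball z (2 * d)"
  define w where "w = (\<lambda>x. - neg_part (zero_extension \<Omega> u) x)"
  define S where "S = \<Omega> \<inter> {x. u x = \<Gamma> x}"
  define I where "I = (LINT x|lebesgue_on S. (pos_part f x)\<^sup>2 * (x $ 1)\<^sup>2)"
  have \<Gamma>': "\<Gamma> = convex_envelope D w" using \<Gamma> by (simp add: D_def d_def w_def)
  have "x0 \<in> ball z (2 * d)" using x0 sub d_def by auto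
  \<comment> \<open>A ball that contains \<open>x0\<close> has positive radius, which rules out a
    zero diameter.\<close>
  then have d: "0 < d" and zx0: "dist z x0 < 2 * d" using zero_le_dist[of z x0] by (auto simp del: zero_le_dist)
  \<comment> \<open>Slopes are measured from \<open>x0\<close>, not from \<open>z\<close>;
    recentring the ball doubles its radius, whence the 4.\<close>
  have cball_sub: "cball z (2 * d) \<subseteq> cball x0 (4 * d)"
  proof
    fix x assume "x \<in> cball z (2 * d)"
    then show "x \<in> cball x0 (4 * d)"
      using zx0 dist_triangle[of x0 x z] by (simp add: dist_commute)
  qed
  have "closure \<Omega> \<subseteq> cball z (2 * d)"
    using sub d_def by (intro closure_minimal) auto
  then have sub': "closure \<Omega> \<subseteq> cball x0 (4 * d)" "\<Omega> \<subseteq> D" "D \<subseteq> cball x0 (4 * d)"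
    using cball_sub sub by (auto simp: D_def d_def)
  have cl: "\<Omega> \<subseteq> closure \<Omega>" by (rule closure_subset)
  have "bounded (u ` closure \<Omega>)"
    using \<Omega>(2) u(1) by (intro compact_imp_bounded compact_continuous_image) (auto simp: compact_closure)
  then obtain K where K: "\<And>x. x \<in> closure \<Omega> \<Longrightarrow> \<bar>u x\<bar> \<le> K" by (auto simp: bounded_iff)
  \<comment> \<open>Off \<open>\<Omega>\<close> the value is 0, and \<open>K\<close> is nonnegative
    because it bounds \<open>\<bar>u x0\<bar>\<close>.\<close>
  have "- K \<le> w y" for y
    using K[of y] K[of x0] x0 cl by (auto simp: w_def neg_part_def zero_extension_def)
  then have S_meas: "S \<in> sets lebesgue"
    unfolding S_def \<Gamma>' using sub'(2) \<Omega>(1) continuous_on_subset[OF u(1) cl]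
    by (intro contact_set_measurable) (auto simp: D_def)
  let ?A = "{x \<in> S. 0 \<le> hess u x $ 1 $ 1 \<and> 0 \<le> hess u x $ 2 $ 2 \<and> 0 \<le> det (hess u x)}"
  have ball: "ball 0 (- u x0 / (4 * d)) \<subseteq> grad u ` ?A"
    using ball_subset_grad_contact_set[OF \<Omega> u _ x0 sub'] bd d
    unfolding S_def \<Gamma>' w_def by auto
  have A: "grad u ` ?A \<in> lmeasurable" "measure lebesgue (grad u ` ?A) \<le> I / (4 * l\<^sup>2)"
    unfolding I_def
    by (rule contact_det_integral_bound[OF l ell \<Omega> u(2) f _ S_meas]; use Lu S_def in auto)+
  have "0 \<le> - u x0 / (4 * d)" using True d by (intro divide_nonneg_nonneg) auto
  then have "pi * (- u x0 / (4 * d))\<^sup>2 = measure lebesgue (ball (0::real^2) (- u x0 / (4 * d)))"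
    using circle_area[of "- u x0 / (4 * d)" 0] by simp
  also have "\<dots> \<le> measure lebesgue (grad u ` ?A)"
    using ball A(1) by (intro measure_mono_fmeasurable) auto
  also have "\<dots> \<le> I / (4 * l\<^sup>2)" by (rule A)
  finally have le: "pi * (- u x0 / (4 * d))\<^sup>2 \<le> I / (4 * l\<^sup>2)" .
  have I: "0 \<le> I" unfolding I_def by (rule Bochner_Integration.integral_nonneg) auto
  have "(u x0)\<^sup>2 = 16 * d\<^sup>2 / pi * (pi * (- u x0 / (4 * d))\<^sup>2)"
    using d by (simp add: power2_eq_square)
  also have "\<dots> \<le> 16 * d\<^sup>2 / pi * (I / (4 * l\<^sup>2))" using le by (intro mult_left_mono) auto
  also have "\<dots> = (2 / (l * sqrt pi) * d * sqrt I)\<^sup>2"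
    using I by (simp add: power_mult_distrib power_divide ac_simps)
  finally have "(u x0)\<^sup>2 \<le> (2 / (l * sqrt pi) * d * sqrt I)\<^sup>2" .
  moreover have "0 \<le> 2 / (l * sqrt pi) * d * sqrt I" using l d I by simp
  ultimately have "\<bar>u x0\<bar> \<le> 2 / (l * sqrt pi) * d * sqrt I"
    by (metis abs_le_square_iff abs_of_nonneg)
  then show ?thesis using True by (simp add: neg_part_def d_def I_def S_def)
qed

theorem theorem2p5:
  fixes l L :: real
  assumes "0 < l" and "l \<le> L"
  shows "\<exists>C>0. \<forall>(a11 :: real^2 \<Rightarrow> real) (a12 :: real^2 \<Rightarrow> real) (a22 :: real^2 \<Rightarrow> real)
      (\<Omega> :: (real^2) set) (u :: real^2 \<Rightarrow> real) (f :: real^2 \<Rightarrow> real) (z :: real^2) (\<Gamma> :: real^2 \<Rightarrow> real).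
    a11 \<in> borel_measurable lebesgue \<longrightarrow>
    a12 \<in> borel_measurable lebesgue \<longrightarrow>
    a22 \<in> borel_measurable lebesgue \<longrightarrow>
    ellipticity_constants l L a11 a12 a22 \<longrightarrow>
    open \<Omega> \<longrightarrow> connected \<Omega> \<longrightarrow> \<Omega> \<noteq> {} \<longrightarrow> bounded \<Omega> \<longrightarrow>
    continuous_on (closure \<Omega>) u \<longrightarrow> C2_on \<Omega> u \<longrightarrow>
    (\<forall>x\<in>frontier \<Omega>. 0 \<le> u x) \<longrightarrow>
    f \<in> borel_measurable (lebesgue_on \<Omega>) \<longrightarrow> bounded (f ` \<Omega>) \<longrightarrow>
    (\<forall>x\<in>\<Omega>. grushin_op a11 a12 a22 u x \<le> f x * (x $ 1)\<^sup>2) \<longrightarrow>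
    \<Omega> \<subseteq> ball z (2 * diameter \<Omega>) \<longrightarrow>
    \<Gamma> = convex_envelope (ball z (2 * diameter \<Omega>)) (\<lambda>x. - neg_part (zero_extension \<Omega> u) x) \<longrightarrow>
    (SUP x\<in>\<Omega>. neg_part u x)
      \<le> C * diameter \<Omega> *
        sqrt (LINT x|lebesgue_on (\<Omega> \<inter> {x. u x = \<Gamma> x}). (pos_part f x)\<^sup>2 * (x $ 1)\<^sup>2)"
proof (intro exI[of _ "2 / (l * sqrt pi)"] conjI allI impI)
  show "0 < 2 / (l * sqrt pi)" using assms(1) by simp
\<comment> \<open>As \<open>\<Omega>\<close> is nonempty, the pointwise estimate passes to the
  real-valued supremum.\<close>
qed (rule cSUP_least, assumption, rule ABP_pointwise[OF assms(1)], assumption+)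

end
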